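(* For all integers $n\ge 2$, $$F_{n}^2=F_{n-1}^2+3F_{n-2}^2+2\sum_{i=3}^nF_{n-i}^2 .$$
   Context: The Fibonacci numbers are $F_0=0$, $F_1=1$, $F_n=F_{n-1}+F_{n-2}$ for $n\ge2$. Empty sums are $0$. *)

theory Defs
  imports "HOL-Number_Theory.Fib"
begin

end

theory Submission
  imports Defs
begin

text \<open>With n = m + 2, expand the square of \<open>fib (m + 2)\<close> =
  \<open>fib (Suc m) + fib m\<close>. The cross term is twice \<open>fib m * fib (Suc m)\<close>,
  which \<open>sum_fib_squares\<close> turns into twice the sum of the squares up to index
  m.\<close>

lemma sum_fib_squares: "(\<Sum>j\<le>m. (fib j)\<^sup>2) = fib m * fib (Suc m)"
  by (induction m) (simp_all add: power2_eq_square algebra_simps)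

theorem mainTheorem2:
  fixes n :: nat
  assumes "n \<ge> 2"
  shows "(fib n)\<^sup>2 = (fib (n - 1))\<^sup>2 + 3 * (fib (n - 2))\<^sup>2 + 2 * (\<Sum>i = 3..n. (fib (n - i))\<^sup>2)"
proof -
  obtain m where n: "n = m + 2"
    using assms by (metis le_add_diff_inverse2)
  have "(\<Sum>i = 3..n. (fib (n - i))\<^sup>2) = (\<Sum>j<m. (fib j)\<^sup>2)"
    by (rule sum.reindex_bij_witness[of _ "\<lambda>j. n - j" "\<lambda>i. n - i"]) (auto simp: n)
  \<comment> \<open>The reindexed sum stops at m - 1, so the square of \<open>fib m\<close> is split
    off; doubled and added to the one from the expansion, it gives the coefficient 3.\<close>
  moreover have "(\<Sum>j<m. (fib j)\<^sup>2) + (fib m)\<^sup>2 = fib m * fib (Suc m)"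
    using sum_fib_squares[of m] by (simp flip: lessThan_Suc_atMost)
  moreover have "(fib (m + 2))\<^sup>2 = (fib (Suc m))\<^sup>2 + 2 * (fib m * fib (Suc m)) + (fib m)\<^sup>2"
    by (simp add: power2_eq_square algebra_simps)
  ultimately show ?thesis
    by (simp add: n)
qed

end
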